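(* Let $a,b,c,d\in\mathbb R$ be admissible parameters (see context) with $c=0$. Let $\lambda>0$, $m\in(0,1]$, $\sigma\in\mathbb R$, let $n\ge 0$ be an integer, let $j_0,\dots,j_n,k_0,\dots,k_n\in\mathbb R$ (with $j_r=k_r=0$ for $r>n$), and set $$\eta(\xi)=\sum_{r=0}^n j_r\,\mathrm{cn}^r(\lambda\xi,m),\qquad w(\xi)=\sum_{r=0}^n k_r\,\mathrm{cn}^r(\lambda\xi,m).$$ Suppose that $(\eta(x-\sigma t),w(x-\sigma t))$ is a solution of the $abcd$-system, i.e. (since $c=0$) that for all $\xi\in\mathbb R$ $$-\sigma\eta'+w'+(\eta w)'+a w'''+b\sigma\eta'''=0,\qquad -\sigma w'+\eta'+ww'+d\sigma w'''=0 .$$ Then: (i) If $b^2+d^2\neq 0$, then $j_r=0$ for all integers $r\ge 5$ and $k_r=0$ for all integers $r\ge 3$, so that $$\eta(\xi)=\sum_{r=0}^4 j_r\,\mathrm{cn}^r(\lambda\xi,m),\qquad w(\xi)=\sum_{r=0}^2 k_r\,\mathrm{cn}^r(\lambda\xi,m).$$ (ii) If $b^2+d^2=0$, then $j_r=k_r=0$ for all integers $r\ge 1$. Consequently, only the trivial solution (both $\eta$ and $w$ constant) exists in this case.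
   Context: The $abcd$-system for real-valued $\eta(x,t),w(x,t)$, $x,t\in\mathbb R$, is $$\eta_t+w_x+(w\eta)_x+a w_{xxx}-b\eta_{xxt}=0,\qquad w_t+\eta_x+ww_x+c\,\eta_{xxx}-d w_{xxt}=0 .$$ The real parameters $a,b,c,d$ are admissible if for some $\theta\in[0,1]$: $a+b=\tfrac12(\theta^2-\tfrac13)$, $c+d=\tfrac12(1-\theta^2)\ge 0$, and $a+b+c+d=\tfrac13$. A traveling-wave solution has the form $\eta=\eta(\xi)$, $w=w(\xi)$, $\xi=x-\sigma t$; primes denote $d/d\xi$. Jacobi elliptic function convention: for $0\le m\le 1$, with $v=\int_0^\phi (1-m^2\sin^2 t)^{-1/2}dt$, one sets $\mathrm{cn}(v,m)=\cos\phi$, $\mathrm{sn}(v,m)=\sin\phi$; $m$ is the elliptic modulus (so $\mathrm{cn}(v,1)=\mathrm{sech}\,v$). $\mathrm{cn}^0\equiv 1$. *)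

theory Defs
  imports "HOL-Analysis.Analysis"
begin

text \<open>The first argument of a function of type \<^typ>\<open>real \<Rightarrow> real \<Rightarrow> real\<close> is the space variable
  \<open>x\<close>, the second one the time variable \<open>t\<close>.\<close>

definition D_x :: "(real \<Rightarrow> real \<Rightarrow> real) \<Rightarrow> real \<Rightarrow> real \<Rightarrow> real" where
  "D_x u x t = deriv (\<lambda>y. u y t) x"

definition D_t :: "(real \<Rightarrow> real \<Rightarrow> real) \<Rightarrow> real \<Rightarrow> real \<Rightarrow> real" where
  "D_t u x t = deriv (\<lambda>s. u x s) t"

definition partially_differentiable :: "(real \<Rightarrow> real \<Rightarrow> real) \<Rightarrow> bool" where
  "partially_differentiable u \<longleftrightarrow>
     (\<forall>x t. (\<lambda>y. u y t) differentiable (at x) \<and> (\<lambda>s. u x s) differentiable (at t))"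

text \<open>Classical solutions on the whole plane. Since \<^const>\<open>deriv\<close> is total, the existence of the
  partial derivatives occurring in the system is demanded explicitly.\<close>

definition abcd_solution ::
    "real \<Rightarrow> real \<Rightarrow> real \<Rightarrow> real \<Rightarrow> (real \<Rightarrow> real \<Rightarrow> real) \<Rightarrow> (real \<Rightarrow> real \<Rightarrow> real) \<Rightarrow> bool" where
  "abcd_solution a b c d \<eta> w \<longleftrightarrow>
     (\<forall>u\<in>{\<eta>, w}. partially_differentiable u \<and> partially_differentiable (D_x u)
                \<and> partially_differentiable (D_x (D_x u))) \<and>
     (\<forall>x t. D_t \<eta> x t + D_x w x t + D_x (\<lambda>x t. w x t * \<eta> x t) x t
              + a * D_x (D_x (D_x w)) x t - b * D_t (D_x (D_x \<eta>)) x t = 0) \<and>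
     (\<forall>x t. D_t w x t + D_x \<eta> x t + w x t * D_x w x t
              + c * D_x (D_x (D_x \<eta>)) x t - d * D_t (D_x (D_x w)) x t = 0)"

definition admissible :: "real \<Rightarrow> real \<Rightarrow> real \<Rightarrow> real \<Rightarrow> bool" where
  "admissible a b c d \<longleftrightarrow>
     (\<exists>\<theta>\<in>{0..1}. a + b = (1/2) * (\<theta>\<^sup>2 - 1/3) \<and> c + d = (1/2) * (1 - \<theta>\<^sup>2) \<and> c + d \<ge> 0
                 \<and> a + b + c + d = 1/3)"

text \<open>The amplitude inverts the incomplete elliptic integral of the first kind with modulus
  \<open>m \<in> [0, 1]\<close>. The integral is oriented, so \<open>\<phi>\<close> may be negative. Integrability holds for all
  \<open>\<phi>\<close> if \<open>m < 1\<close>; for \<open>m = 1\<close> it restricts \<open>\<phi>\<close> to \<open>(-\<pi>/2, \<pi>/2)\<close>, which excludes the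
  junk values of a divergent integral.\<close>

definition jacobi_am :: "real \<Rightarrow> real \<Rightarrow> real" where
  "jacobi_am v m = (THE \<phi>.
     interval_lebesgue_integrable lborel 0 (ereal \<phi>) (\<lambda>t. (1 - m\<^sup>2 * (sin t)\<^sup>2) powr (-1/2)) \<and>
     v = (LBINT t=0..ereal \<phi>. (1 - m\<^sup>2 * (sin t)\<^sup>2) powr (-1/2)))"

definition jacobi_cn :: "real \<Rightarrow> real \<Rightarrow> real" where
  "jacobi_cn v m = cos (jacobi_am v m)"

text \<open>For smooth profiles, a traveling wave solves the system iff the profiles satisfy the
  traveling-wave ordinary differential equations.\<close>

lemma D_x_travel:
  assumes "\<And>z. f differentiable (at z)"
  shows "D_x (\<lambda>x t. f (x - \<sigma> * t)) = (\<lambda>x t. deriv f (x - \<sigma> * t))"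
proof (intro ext)
  fix x t :: real
  have "(f has_real_derivative deriv f (x - \<sigma> * t)) (at (x - \<sigma> * t))"
    using assms by (simp add: DERIV_deriv_iff_real_differentiable)
  then have "((\<lambda>y. f (y - \<sigma> * t)) has_real_derivative deriv f (x - \<sigma> * t) * 1) (at x)"
    by (rule DERIV_chain2) (auto intro!: derivative_eq_intros)
  then show "D_x (\<lambda>x t. f (x - \<sigma> * t)) x t = deriv f (x - \<sigma> * t)"
    unfolding D_x_def by (simp add: DERIV_imp_deriv)
qed

lemma D_t_travel:
  assumes "\<And>z. f differentiable (at z)"
  shows "D_t (\<lambda>x t. f (x - \<sigma> * t)) = (\<lambda>x t. - \<sigma> * deriv f (x - \<sigma> * t))"
proof (intro ext)
  fix x t :: real
  have "(f has_real_derivative deriv f (x - \<sigma> * t)) (at (x - \<sigma> * t))"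
    using assms by (simp add: DERIV_deriv_iff_real_differentiable)
  then have "((\<lambda>s. f (x - \<sigma> * s)) has_real_derivative deriv f (x - \<sigma> * t) * (- \<sigma>)) (at t)"
    by (rule DERIV_chain2) (auto intro!: derivative_eq_intros)
  then show "D_t (\<lambda>x t. f (x - \<sigma> * t)) x t = - \<sigma> * deriv f (x - \<sigma> * t)"
    unfolding D_t_def by (simp add: DERIV_imp_deriv mult.commute)
qed

lemma partially_differentiable_travel:
  assumes "\<And>z. f differentiable (at z)"
  shows "partially_differentiable (\<lambda>x t. f (x - \<sigma> * t))"
  unfolding partially_differentiable_def
proof (intro allI conjI)
  fix x t :: real
  have f: "(f has_real_derivative deriv f (x - \<sigma> * t)) (at (x - \<sigma> * t))"
    using assms by (simp add: DERIV_deriv_iff_real_differentiable)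
  have "((\<lambda>y. f (y - \<sigma> * t)) has_real_derivative deriv f (x - \<sigma> * t) * 1) (at x)"
    using f by (rule DERIV_chain2) (auto intro!: derivative_eq_intros)
  then show "(\<lambda>y. f (y - \<sigma> * t)) differentiable (at x)"
    using real_differentiable_def by blast
  have "((\<lambda>s. f (x - \<sigma> * s)) has_real_derivative deriv f (x - \<sigma> * t) * (- \<sigma>)) (at t)"
    using f by (rule DERIV_chain2) (auto intro!: derivative_eq_intros)
  then show "(\<lambda>s. f (x - \<sigma> * s)) differentiable (at t)"
    using real_differentiable_def by blast
qed

lemma abcd_solution_travel_iff:
  assumes e: "\<And>z. \<eta> differentiable (at z)" "\<And>z. deriv \<eta> differentiable (at z)"
      "\<And>z. deriv (deriv \<eta>) differentiable (at z)"
    and w: "\<And>z. w differentiable (at z)" "\<And>z. deriv w differentiable (at z)"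
      "\<And>z. deriv (deriv w) differentiable (at z)"
  shows "abcd_solution a b c d (\<lambda>x t. \<eta> (x - \<sigma> * t)) (\<lambda>x t. w (x - \<sigma> * t)) \<longleftrightarrow>
    (\<forall>\<xi>. - \<sigma> * deriv \<eta> \<xi> + deriv w \<xi> + deriv (\<lambda>\<xi>. \<eta> \<xi> * w \<xi>) \<xi>
           + a * deriv (deriv (deriv w)) \<xi> + b * \<sigma> * deriv (deriv (deriv \<eta>)) \<xi> = 0) \<and>
    (\<forall>\<xi>. - \<sigma> * deriv w \<xi> + deriv \<eta> \<xi> + w \<xi> * deriv w \<xi>
           + c * deriv (deriv (deriv \<eta>)) \<xi> + d * \<sigma> * deriv (deriv (deriv w)) \<xi> = 0)"
proof -
  have p: "(\<lambda>\<xi>. \<eta> \<xi> * w \<xi>) differentiable (at z)" for z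
    using e(1) w(1) by (intro differentiable_mult)
  have all: "(\<forall>x t. P (x - \<sigma> * t)) \<longleftrightarrow> (\<forall>\<xi>. P \<xi>)" for P :: "real \<Rightarrow> bool"
    by (metis diff_zero mult_zero_right)
  have comm: "(\<lambda>x t. w (x - \<sigma> * t) * \<eta> (x - \<sigma> * t)) = (\<lambda>x t. \<eta> (x - \<sigma> * t) * w (x - \<sigma> * t))"
    by (simp add: mult.commute)
  define E where "E \<xi> = - \<sigma> * deriv \<eta> \<xi> + deriv w \<xi> + deriv (\<lambda>\<xi>. \<eta> \<xi> * w \<xi>) \<xi>
           + a * deriv (deriv (deriv w)) \<xi> + b * \<sigma> * deriv (deriv (deriv \<eta>)) \<xi>" for \<xi>
  define F where "F \<xi> = - \<sigma> * deriv w \<xi> + deriv \<eta> \<xi> + w \<xi> * deriv w \<xi>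
           + c * deriv (deriv (deriv \<eta>)) \<xi> + d * \<sigma> * deriv (deriv (deriv w)) \<xi>" for \<xi>
  have "abcd_solution a b c d (\<lambda>x t. \<eta> (x - \<sigma> * t)) (\<lambda>x t. w (x - \<sigma> * t)) \<longleftrightarrow>
      (\<forall>x t. E (x - \<sigma> * t) = 0) \<and> (\<forall>x t. F (x - \<sigma> * t) = 0)"
    unfolding abcd_solution_def comm E_def F_def
    by (simp add: D_x_travel[OF p, of \<sigma>] D_x_travel D_t_travel e w partially_differentiable_travel mult.assoc)
  also have "\<dots> \<longleftrightarrow> (\<forall>\<xi>. E \<xi> = 0) \<and> (\<forall>\<xi>. F \<xi> = 0)"
    using all[of "\<lambda>z. E z = 0"] all[of "\<lambda>z. F z = 0"] by simp
  finally show ?thesis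
    unfolding E_def F_def .
qed

end

(* Squaring cn' = - sn dn gives cn'^2 = (1 - cn^2) (1 - m^2 + m^2 cn^2), a quartic in cn. Hence along
   eta = P(y), w = Q(y), y = cn(lam xi), both equations become y' times a polynomial in y; as y takes
   infinitely many values, these polynomials vanish, and being derivatives they integrate to
     - s Q + P + Q^2/2 + d s D Q = const,    - s P + Q + P Q + a D Q + b s D P = const,
   where D raises degrees by at most 2. If deg Q = N > 2, then deg P = 2 N by the first relation, and
   P Q of degree 3 N cannot be cancelled in the second; so deg Q <= 2 and deg P <= 4.
   If b = d = 0, the same comparison excludes N = 2, and for N = 1 the y^3-coefficients of P Q and
   a D Q have the same sign since a = 1/3. *)

theory Submission
  imports Defs "HOL-Computational_Algebra.Polynomial"
begin

section \<open>The elliptic integrand and strict monotonicity of its integral\<close>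

definition ell_integrand :: "real \<Rightarrow> real \<Rightarrow> real" where
  "ell_integrand m t = (1 - m\<^sup>2 * (sin t)\<^sup>2) powr (-1/2)"

lemma delta_ge_cos:
  fixes m t :: real
  assumes "0 \<le> m" "m \<le> 1"
  shows "(cos t)\<^sup>2 \<le> 1 - m\<^sup>2 * (sin t)\<^sup>2"
proof -
  have "m\<^sup>2 \<le> 1" using assms by (simp add: power_le_one)
  then have "m\<^sup>2 * (sin t)\<^sup>2 \<le> 1 * (sin t)\<^sup>2" by (intro mult_right_mono) auto
  then show ?thesis using sin_cos_squared_add[of t] by linarith
qed

lemma delta_pos:
  fixes m t :: real
  assumes "0 \<le> m" "m < 1"
  shows "0 < 1 - m\<^sup>2 * (sin t)\<^sup>2"
proof -
  have "m\<^sup>2 < 1" using assms by (simp add: power_less_one_iff)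
  moreover have "m\<^sup>2 * (sin t)\<^sup>2 \<le> m\<^sup>2 * 1" by (intro mult_left_mono) (auto simp: sin_squared_eq)
  ultimately show ?thesis by linarith
qed

lemma ell_integrand_ge_1:
  assumes "1 - m\<^sup>2 * (sin t)\<^sup>2 > 0"
  shows "ell_integrand m t \<ge> 1"
proof -
  have "1 - m\<^sup>2 * (sin t)\<^sup>2 \<le> 1" by simp
  then have "1 powr (-1/2) \<le> (1 - m\<^sup>2 * (sin t)\<^sup>2) powr (-1/2)"
    by (intro powr_mono2') (use assms in auto)
  then show ?thesis by (simp add: ell_integrand_def)
qed

text \<open>Unlike \<open>ell_integrand m t \<ge> 1\<close>, this bound survives at the singularities for \<open>m = 1\<close>, where \<open>0 powr (-1/2) = 0\<close>.\<close>

lemma cos_sq_le_ell_integrand: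
  assumes "0 \<le> m" "m \<le> 1"
  shows "(cos t)\<^sup>2 \<le> ell_integrand m t"
proof (cases "1 - m\<^sup>2 * (sin t)\<^sup>2 > 0")
  case True
  have "(cos t)\<^sup>2 \<le> 1" by (simp add: cos_squared_eq)
  then show ?thesis using ell_integrand_ge_1[OF True] by linarith
next
  case False
  then have "(cos t)\<^sup>2 \<le> 0" using delta_ge_cos[OF assms, of t] by linarith
  moreover have "0 \<le> ell_integrand m t" by (simp add: ell_integrand_def)
  ultimately show ?thesis by linarith
qed

lemma isCont_ell_integrand:
  assumes "1 - m\<^sup>2 * (sin t)\<^sup>2 > 0"
  shows "isCont (ell_integrand m) t"
proof -
  have "isCont (\<lambda>t. (1 - m\<^sup>2 * (sin t)\<^sup>2) powr (-1/2)) t"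
    by (intro continuous_intros) (use assms in auto)
  then show ?thesis by (simp add: ell_integrand_def[abs_def])
qed

text \<open>Up to 1, strictness comes from sin x = 2 sin (x/2) cos (x/2) with |cos (x/2)| < 1;
  beyond 1, from |sin x| <= 1.\<close>

lemma abs_sin_less:
  fixes x :: real
  assumes "0 < x"
  shows "\<bar>sin x\<bar> < x"
proof (cases "x \<le> 1")
  case True
  then have "sin (x/2) > 0" using assms pi_gt3 by (intro sin_gt_zero) auto
  then have "(cos (x/2))\<^sup>2 < 1" by (simp add: cos_squared_eq)
  then have c: "\<bar>cos (x/2)\<bar> < 1" by (simp add: abs_square_less_1)
  have "\<bar>sin x\<bar> = 2 * \<bar>sin (x/2)\<bar> * \<bar>cos (x/2)\<bar>"
    using sin_double[of "x/2"] by (simp add: abs_mult)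
  also have "\<dots> \<le> x * \<bar>cos (x/2)\<bar>"
    using abs_sin_x_le_abs_x[of "x/2"] assms by (intro mult_right_mono) auto
  also have "\<dots> < x * 1" using c assms by (intro mult_strict_left_mono) auto
  finally show ?thesis by simp
next
  case False
  then show ?thesis using abs_sin_le_one[of x] by linarith
qed

text \<open>In the antiderivative (t + sin t cos t) / 2 the trigonometric part changes by sin (q -
  p) cos (q + p) / 2, strictly less in size than the linear part (q - p) / 2.\<close>

lemma interval_integral_cos_sq_pos:
  fixes p q :: real
  assumes "p < q"
  shows "0 < (LBINT t=p..q. (cos t)\<^sup>2)"
proof -
  have eq: "(LBINT t=p..q. (cos t)\<^sup>2) = (q + sin q * cos q) / 2 - (p + sin p * cos p) / 2"
  proof (rule interval_integral_FTC_finite)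
    show "((\<lambda>t. (t + sin t * cos t) / 2) has_vector_derivative (cos x)\<^sup>2)
        (at x within {min p q..max p q})" for x
      unfolding has_real_derivative_iff_has_vector_derivative[symmetric]
      by (auto intro!: derivative_eq_intros simp: power2_eq_square[symmetric] cos_squared_eq)
  qed (intro continuous_intros)
  have "\<bar>sin (q - p)\<bar> < q - p"
    using abs_sin_less[of "q - p"] \<open>p < q\<close> by simp
  moreover have "sin q * cos q - sin p * cos p = sin (q - p) * cos (q + p)"
    unfolding sin_diff cos_add
    using sin_cos_squared_add[of p] sin_cos_squared_add[of q] by algebra
  moreover have "\<bar>sin (q - p) * cos (q + p)\<bar> \<le> \<bar>sin (q - p)\<bar> * 1"
    unfolding abs_mult by (intro mult_left_mono) auto
  ultimately have "0 < (q - p) + (sin q * cos q - sin p * cos p)"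
    by (smt (verit))
  then have "0 < (q + sin q * cos q) / 2 - (p + sin p * cos p) / 2"
    by (simp add: field_simps)
  with eq show ?thesis by simp
qed

lemma ell_integral_pos:
  fixes p q :: real
  assumes m: "0 \<le> m" "m \<le> 1" and "p < q"
    and int: "interval_lebesgue_integrable lborel p q (ell_integrand m)"
  shows "0 < (LBINT t=p..q. ell_integrand m t)"
proof -
  have "interval_lebesgue_integrable lborel p q (\<lambda>t. (cos t)\<^sup>2)"
    by (rule interval_integrable_isCont) (auto intro!: continuous_intros)
  then have "(LBINT t=p..q. (cos t)\<^sup>2) \<le> (LBINT t=p..q. ell_integrand m t)"
    using int \<open>p < q\<close> unfolding interval_lebesgue_integral_def interval_lebesgue_integrable_def
    by (auto intro!: set_integral_mono cos_sq_le_ell_integrand m simp del: einterval_eq)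
  then show ?thesis using interval_integral_cos_sq_pos[OF \<open>p < q\<close>] by linarith
qed

text \<open>Integrability is given only from 0, so the position of 0 decides: outside (p, q) the
  difference is the integral over [p, q]; inside, the two oriented integrals have opposite
  signs.\<close>

lemma ell_integral_strict_mono:
  fixes p q :: real
  assumes m: "0 \<le> m" "m \<le> 1" and pq: "p < q"
    and p: "interval_lebesgue_integrable lborel 0 p (ell_integrand m)"
    and q: "interval_lebesgue_integrable lborel 0 q (ell_integrand m)"
  shows "(LBINT t=0..p. ell_integrand m t) < (LBINT t=0..q. ell_integrand m t)"
proof -
  note def = interval_lebesgue_integrable_def
  consider "0 \<le> p" | "q \<le> 0" | "p < 0" "0 < q" by linarith
  then show ?thesis
  proof cases
    case 1
    then have I: "interval_lebesgue_integrable lborel p q (ell_integrand m)"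
      using q pq unfolding def by (auto simp: zero_ereal_def elim!: set_integrable_subset)
    have "(LBINT t=0..p. ell_integrand m t) + (LBINT t=p..q. ell_integrand m t) = (LBINT t=0..q. ell_integrand m t)"
      by (rule interval_integral_sum) (use q pq 1 in \<open>simp add: zero_ereal_def min_absorb1 max_absorb2\<close>)
    then show ?thesis using ell_integral_pos[OF m pq I] by linarith
  next
    case 2
    then have I: "interval_lebesgue_integrable lborel p q (ell_integrand m)"
      using p pq unfolding def by (auto simp: zero_ereal_def elim!: set_integrable_subset)
    have "(LBINT t=p..q. ell_integrand m t) + (LBINT t=q..0. ell_integrand m t) = (LBINT t=p..0. ell_integrand m t)"
      by (rule interval_integral_sum)
        (use p pq 2 interval_integrable_endpoints_reverse[of 0 p "ell_integrand m"]
          in \<open>simp add: zero_ereal_def min_absorb1 max_absorb2\<close>)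
    then show ?thesis using ell_integral_pos[OF m pq I]
      using interval_integral_endpoints_reverse[of 0 p "ell_integrand m"] interval_integral_endpoints_reverse[of 0 q "ell_integrand m"]
      by linarith
  next
    case 3
    have "0 < (LBINT t=0..q. ell_integrand m t)"
      using ell_integral_pos[OF m \<open>0 < q\<close>] q by (simp add: zero_ereal_def)
    moreover have "0 < (LBINT t=p..0. ell_integrand m t)"
      using ell_integral_pos[OF m \<open>p < 0\<close>] p by (simp add: zero_ereal_def interval_integrable_endpoints_reverse)
    ultimately show ?thesis using interval_integral_endpoints_reverse[of 0 p "ell_integrand m"] by linarith
  qed
qed

section \<open>The amplitude and its derivative\<close>

text \<open>Strict monotonicity makes the description unique. It covers every \<open>q\<close> with
  an integrable integrand, so for \<open>m = 1\<close> also candidates outside (-pi/2,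
  pi/2).\<close>

lemma jacobi_am_eqI:
  fixes v p :: real
  assumes m: "0 \<le> m" "m \<le> 1"
    and int: "interval_lebesgue_integrable lborel 0 p (ell_integrand m)"
    and v: "v = (LBINT t=0..p. ell_integrand m t)"
  shows "jacobi_am v m = p"
  unfolding jacobi_am_def ell_integrand_def[symmetric]
proof (rule the_equality)
  fix q :: real
  assume q: "interval_lebesgue_integrable lborel 0 q (ell_integrand m) \<and> v = (LBINT t=0..q. ell_integrand m t)"
  show "q = p"
    using ell_integral_strict_mono[OF m, of p q] ell_integral_strict_mono[OF m, of q p] int v q
    by (cases p q rule: linorder_cases) auto
qed (use int v in auto)

text \<open>This is the Gudermannian function: between 0 and \<open>arctan (sinh v)\<close> the
  integrand is sec, with antiderivative arsinh (tan x).\<close>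

lemma jacobi_am_1: "jacobi_am v 1 = arctan (sinh v)"
proof (rule jacobi_am_eqI)
  let ?p = "arctan (sinh v)"
  have cos: "cos x > 0" if "min 0 ?p \<le> x" "x \<le> max 0 ?p" for x
    using that arctan_bounded[of "sinh v"] by (intro cos_gt_zero_pi) (auto simp: min_def max_def split: if_splits)
  have D: "1 - 1\<^sup>2 * (sin x)\<^sup>2 = (cos x)\<^sup>2" for x :: real
    by (simp add: cos_squared_eq)
  have cont: "isCont (ell_integrand 1) x" if "min 0 ?p \<le> x" "x \<le> max 0 ?p" for x
    using isCont_ell_integrand[of 1 x] cos[OF that] unfolding D by simp
  have eq: "ell_integrand 1 x = inverse (cos x)" if "cos x > 0" for x
  proof -
    have "ell_integrand 1 x = (cos x ^ 2) powr (-1/2)" unfolding ell_integrand_def D ..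
    also have "\<dots> = inverse (cos x)"
      using that by (simp add: powr_minus powr_half_sqrt)
    finally show ?thesis .
  qed
  have "interval_lebesgue_integrable lborel (ereal 0) (ereal ?p) (ell_integrand 1)"
    by (rule interval_integrable_isCont) (use cont in auto)
  then show "interval_lebesgue_integrable lborel 0 (ereal ?p) (ell_integrand 1)"
    by (simp add: zero_ereal_def)
  have "(LBINT t=ereal 0..ereal ?p. ell_integrand 1 t) = arsinh (tan ?p) - arsinh (tan 0)"
  proof (rule interval_integral_FTC_finite)
    show "continuous_on {min 0 ?p..max 0 ?p} (ell_integrand 1)"
      using cont by (intro continuous_at_imp_continuous_on) auto
    fix x assume x: "min 0 ?p \<le> x" "x \<le> max 0 ?p"
    have c: "cos x > 0" using cos[OF x] .
    have "1 + (tan x)\<^sup>2 = inverse ((cos x)\<^sup>2)"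
      using tan_sec[of x] c by (simp add: power_inverse)
    then have s: "sqrt ((tan x)\<^sup>2 + 1) = inverse (cos x)"
      using c by (simp add: real_sqrt_inverse add.commute)
    have "((\<lambda>x. arsinh (tan x)) has_real_derivative ell_integrand 1 x) (at x)"
    proof (rule DERIV_cong)
      show "((\<lambda>x. arsinh (tan x)) has_real_derivative
          1 / sqrt ((tan x)\<^sup>2 + 1) * inverse ((cos x)\<^sup>2)) (at x)"
        using c by (intro DERIV_chain2[OF arsinh_real_has_field_derivative] DERIV_tan) auto
      show "1 / sqrt ((tan x)\<^sup>2 + 1) * inverse ((cos x)\<^sup>2) = ell_integrand 1 x"
        unfolding s eq[OF c] using c by (simp add: power2_eq_square)
    qed
    then show "((\<lambda>x. arsinh (tan x)) has_vector_derivative ell_integrand 1 x)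
        (at x within {min 0 ?p..max 0 ?p})"
      by (simp add: has_real_derivative_iff_has_vector_derivative has_vector_derivative_at_within)
  qed
  then show "v = (LBINT t=0..ereal ?p. ell_integrand 1 t)"
    by (simp add: zero_ereal_def tan_arctan arsinh_sinh_real)
qed auto

lemma jacobi_am_deriv_1:
  "((\<lambda>v. jacobi_am v 1) has_real_derivative sqrt (1 - 1\<^sup>2 * (sin (jacobi_am v 1))\<^sup>2)) (at v)"
proof -
  have c: "cosh v ^ 2 = 1 + sinh v ^ 2" by (simp add: cosh_square_eq)
  have c': "sqrt (1 + sinh v ^ 2) = cosh v" unfolding c[symmetric] by simp
  have "sqrt (1 - 1\<^sup>2 * (sin (arctan (sinh v)))\<^sup>2) = sqrt ((cos (arctan (sinh v)))\<^sup>2)"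
    by (simp add: cos_squared_eq)
  also have "\<dots> = inverse (cosh v)"
    unfolding cos_arctan c' by (simp add: real_sqrt_divide field_simps)
  also have "\<dots> = inverse (1 + (sinh v)\<^sup>2) * cosh v"
    unfolding c[symmetric] by (simp add: power2_eq_square)
  finally show ?thesis
    unfolding jacobi_am_1 by (auto intro!: derivative_eq_intros)
qed

text \<open>For \<open>m < 1\<close> the integral \<open>G\<close> has slope at least 1 on the whole
  line, so it is bijective with the amplitude as inverse, whose derivative is the reciprocal of the
  integrand.\<close>

lemma jacobi_am_deriv_less_1:
  assumes m: "0 \<le> m" "m < 1"
  shows "((\<lambda>v. jacobi_am v m) has_real_derivative sqrt (1 - m\<^sup>2 * (sin (jacobi_am v m))\<^sup>2)) (at v)"
proof -
  define G where "G p = (LBINT t=0..ereal p. ell_integrand m t)" for p :: real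
  note pos = delta_pos[OF m]
  have cont: "isCont (ell_integrand m) t" for t using isCont_ell_integrand[OF pos] .
  have int: "interval_lebesgue_integrable lborel 0 (ereal p) (ell_integrand m)" for p
    unfolding zero_ereal_def by (rule interval_integrable_isCont) (use cont in auto)
  have dG: "(G has_real_derivative ell_integrand m p) (at p)" for p
  proof -
    \<comment> \<open>The interval contains 0 and has \<open>p\<close> in its interior, so the
      derivative within it is the full one.\<close>
    define M where "M = \<bar>p\<bar> + 1"
    have "((\<lambda>u. LBINT t=ereal 0..ereal u. ell_integrand m t) has_vector_derivative ell_integrand m p)
        (at p within {-M..M})"
      by (rule interval_integral_FTC2)
        (use cont in \<open>auto simp: M_def intro!: continuous_at_imp_continuous_on\<close>)
    moreover have "at p within {-M..M} = at p"
      by (rule at_within_interior) (auto simp: M_def)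
    ultimately show ?thesis
      by (simp add: G_def[abs_def] zero_ereal_def has_real_derivative_iff_has_vector_derivative)
  qed
  have contG: "isCont G p" for p using DERIV_isCont[OF dG] .
  have growth: "q - p \<le> G q - G p" if "p \<le> q" for p q
  proof -
    have "(\<lambda>x. G x - x) p \<le> (\<lambda>x. G x - x) q"
      by (rule DERIV_nonneg_imp_nondecreasing[OF that])
        (auto intro!: exI derivative_eq_intros dG simp: ell_integrand_ge_1[OF pos])
    then show ?thesis by simp
  qed
  have G0: "G 0 = 0" by (simp add: G_def zero_ereal_def)
  have am: "jacobi_am (G p) m = p" for p
    by (rule jacobi_am_eqI) (use m int in \<open>auto simp: G_def\<close>)
  have surj: "\<exists>p. G p = v" for v
  proof -
    \<comment> \<open>\<open>growth\<close> and \<open>G0\<close> give G (-|v|) <= -|v| and |v| <= G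
      |v|, so these values enclose \<open>v\<close>.\<close>
    have "\<exists>p. -\<bar>v\<bar> \<le> p \<and> p \<le> \<bar>v\<bar> \<and> G p = v"
      by (rule IVT) (use growth[of 0 "\<bar>v\<bar>"] growth[of "-\<bar>v\<bar>" 0] contG G0 in auto)
    then show ?thesis by blast
  qed
  have inv: "G (jacobi_am v m) = v" for v using surj[of v] am by metis
  have contam: "isCont (\<lambda>v. jacobi_am v m) v" for v
    using isCont_inverse_function[of 1 "jacobi_am v m" "\<lambda>v. jacobi_am v m" G] am contG
    by (simp add: inv)
  have "((\<lambda>v. jacobi_am v m) has_real_derivative inverse (ell_integrand m (jacobi_am v m))) (at v)"
    by (rule DERIV_inverse_function[of G, where a = "v - 1" and b = "v + 1"])
      (use dG contam inv ell_integrand_ge_1[OF pos, of "jacobi_am v m"] in auto)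
  moreover have "inverse (ell_integrand m t) = sqrt (1 - m\<^sup>2 * (sin t)\<^sup>2)" for t
    using pos[of t] by (simp add: ell_integrand_def powr_minus powr_half_sqrt)
  ultimately show ?thesis by simp
qed

lemma jacobi_am_deriv:
  assumes "0 \<le> m" "m \<le> 1"
  shows "((\<lambda>v. jacobi_am v m) has_real_derivative sqrt (1 - m\<^sup>2 * (sin (jacobi_am v m))\<^sup>2)) (at v)"
  using jacobi_am_deriv_less_1[of m v] jacobi_am_deriv_1[of v] assms by (cases "m = 1") auto

lemma jacobi_am_0:
  assumes "0 \<le> m" "m \<le> 1"
  shows "jacobi_am 0 m = 0"
  by (rule jacobi_am_eqI) (use assms in \<open>auto simp: zero_ereal_def interval_lebesgue_integrable_def set_integrable_def\<close>)

section \<open>The derivative of cn and its square\<close>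

lemma jacobi_cn_0:
  assumes "0 \<le> m" "m \<le> 1"
  shows "jacobi_cn 0 m = 1"
  using jacobi_am_0[OF assms] by (simp add: jacobi_cn_def)

definition sndn :: "real \<Rightarrow> real \<Rightarrow> real" where
  "sndn v m = sin (jacobi_am v m) * sqrt (1 - m\<^sup>2 * (sin (jacobi_am v m))\<^sup>2)"

lemma jacobi_cn_deriv:
  assumes "0 \<le> m" "m \<le> 1"
  shows "((\<lambda>v. jacobi_cn v m) has_real_derivative - sndn v m) (at v)"
  unfolding jacobi_cn_def sndn_def
  by (auto intro!: derivative_eq_intros jacobi_am_deriv assms)

lemma sndn_sq:
  assumes "0 \<le> m" "m \<le> 1"
  shows "(sndn v m)\<^sup>2 = (1 - (jacobi_cn v m)\<^sup>2) * (1 - m\<^sup>2 + m\<^sup>2 * (jacobi_cn v m)\<^sup>2)"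
proof -
  have "0 \<le> 1 - m\<^sup>2 * (sin (jacobi_am v m))\<^sup>2"
    using delta_ge_cos[OF assms] by (meson order_trans zero_le_power2)
  then show ?thesis
    unfolding sndn_def jacobi_cn_def power_mult_distrib
    by (simp add: sin_squared_eq algebra_simps)
qed

section \<open>Derivatives of polynomials in a solution of y'^2 = R(y)\<close>

text \<open>If \<open>(y')\<^sup>2 = R(y)\<close> and hence \<open>y'' = R'(y) / 2\<close>, the second derivative of \<open>f(y)\<close> is \<open>(D2 R f)(y)\<close>.\<close>

definition D2 :: "real poly \<Rightarrow> real poly \<Rightarrow> real poly" where
  "D2 R f = pderiv (pderiv f) * R + smult (1/2) (pderiv f * pderiv R)"

text \<open>\<open>z\<close> stands for y'. Differentiating \<open>z_sq\<close> would determine z'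
  only away from the zeros of \<open>z\<close>, hence the separate assumption
  \<open>z_deriv\<close>.\<close>

locale elliptic_profile =
  fixes y z :: "real \<Rightarrow> real" and R :: "real poly"
  assumes y_deriv: "\<And>x. (y has_real_derivative z x) (at x)"
    and z_sq: "\<And>x. (z x)\<^sup>2 = poly R (y x)"
    and z_deriv: "\<And>x. (z has_real_derivative poly (pderiv R) (y x) / 2) (at x)"
begin

lemma poly_deriv: "((\<lambda>x. poly f (y x)) has_real_derivative poly (pderiv f) (y x) * z x) (at x)"
  by (rule DERIV_chain2[OF poly_DERIV y_deriv])

lemma poly_deriv_z: "((\<lambda>x. poly (pderiv f) (y x) * z x) has_real_derivative poly (D2 R f) (y x)) (at x)"
proof -
  have "((\<lambda>x. poly (pderiv f) (y x) * z x) has_real_derivative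
      poly (pderiv (pderiv f)) (y x) * z x * z x + poly (pderiv R) (y x) / 2 * poly (pderiv f) (y x)) (at x)"
    by (rule DERIV_mult[OF poly_deriv z_deriv])
  moreover have "poly (pderiv (pderiv f)) (y x) * z x * z x + poly (pderiv R) (y x) / 2 * poly (pderiv f) (y x) = poly (D2 R f) (y x)"
    unfolding D2_def poly_add poly_mult poly_smult z_sq[symmetric]
    by (simp add: power2_eq_square)
  ultimately show ?thesis by simp
qed

lemma deriv1: "deriv (\<lambda>x. poly f (y x)) = (\<lambda>x. poly (pderiv f) (y x) * z x)"
  by (rule ext) (rule DERIV_imp_deriv[OF poly_deriv])

lemma deriv2: "deriv (deriv (\<lambda>x. poly f (y x))) = (\<lambda>x. poly (D2 R f) (y x))"
  unfolding deriv1 by (rule ext) (rule DERIV_imp_deriv[OF poly_deriv_z])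

text \<open>The second derivative is again a polynomial in \<open>y\<close>, free of
  \<open>z\<close>, so one more derivative is an instance of \<open>deriv1\<close>.\<close>

lemma deriv3: "deriv (deriv (deriv (\<lambda>x. poly f (y x)))) = (\<lambda>x. poly (pderiv (D2 R f)) (y x) * z x)"
  unfolding deriv2 by (rule deriv1)

lemma differentiable:
  "(\<lambda>x. poly f (y x)) differentiable (at x)"
  "deriv (\<lambda>x. poly f (y x)) differentiable (at x)"
  "deriv (deriv (\<lambda>x. poly f (y x))) differentiable (at x)"
  unfolding real_differentiable_def deriv2
  unfolding deriv1
  by (rule exI, rule poly_deriv poly_deriv_z)+

text \<open>Squaring the assumption turns it into \<open>(S\<^sup>2 R)(y) = 0\<close>, so the zeros of \<open>z\<close> do no harm.\<close>

lemma poly_eq_0I: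
  assumes "R \<noteq> 0" "infinite (range y)" "\<And>x. poly S (y x) * z x = 0"
  shows "S = 0"
proof -
  have "poly (S * R) (y x) = 0" for x
    using assms(3)[of x] by (simp flip: z_sq)
  then have "range y \<subseteq> {t. poly (S * R) t = 0}" by auto
  then have "infinite {t. poly (S * R) t = 0}" using assms(2) finite_subset by blast
  then have "S * R = 0" using poly_roots_finite by blast
  then show ?thesis using \<open>R \<noteq> 0\<close> by simp
qed

end

section \<open>Degree comparison in the integrated equations\<close>

text \<open>The summands have degree at most deg f - 2 + 4 and deg f - 1 + 3. For deg f <= 1
  truncated subtraction spoils this count, so constant and linear \<open>f\<close> are treated
  separately.\<close>

lemma degree_D2_le: "degree R \<le> 4 \<Longrightarrow> degree (D2 R f) \<le> degree f + 2"
proof (cases "degree f \<le> 1")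
  case True
  assume R: "degree R \<le> 4"
  have "degree (pderiv f) = 0" using True by (simp add: degree_pderiv)
  then have "pderiv (pderiv f) = 0" by (simp add: pderiv_eq_0_iff)
  show ?thesis
  proof (cases "degree f = 0")
    case True
    then have "pderiv f = 0" by (simp add: pderiv_eq_0_iff)
    then show ?thesis by (simp add: D2_def)
  next
    case False
    have "degree (D2 R f) \<le> degree (pderiv f * pderiv R)"
      by (simp add: D2_def \<open>pderiv (pderiv f) = 0\<close> degree_smult_le)
    also have "\<dots> \<le> degree (pderiv f) + degree (pderiv R)" by (rule degree_mult_le)
    also have "\<dots> \<le> 3" using R \<open>degree (pderiv f) = 0\<close> by (simp add: degree_pderiv)
    finally show ?thesis using False by linarith
  qed
next
  case False
  assume R: "degree R \<le> 4"
  have "degree (pderiv (pderiv f) * R) \<le> degree (pderiv (pderiv f)) + degree R" by (rule degree_mult_le)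
  moreover have "degree (pderiv f * pderiv R) \<le> degree (pderiv f) + degree (pderiv R)" by (rule degree_mult_le)
  ultimately show ?thesis unfolding D2_def using R False
    by (intro degree_add_le order.trans[OF degree_smult_le]) (auto simp: degree_pderiv)
qed

text \<open>If \<open>Q\<close> has large degree \<open>N\<close>, the second equation forces \<open>degree P = 2 * N\<close>, and then \<open>P * Q\<close>, of
  degree \<open>3 * N\<close>, dominates all other terms of the first equation.\<close>

lemma profile_degree_neq:
  fixes P Q R :: "real poly"
  assumes R: "degree R \<le> 4"
    and U: "pderiv (smult (- s) Q + P + smult (1/2) (Q * Q) + smult e (D2 R Q)) = 0"
    and T: "pderiv (smult (- s) P + Q + P * Q + smult a (D2 R Q) + smult g (D2 R P)) = 0"
    and N: "2 < N \<or> g = 0 \<and> e = 0 \<and> 1 < N"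
  shows "degree Q \<noteq> N"
proof
  assume K: "degree Q = N"
  have Q0: "Q \<noteq> 0" using K N by auto
  define U' where "U' = smult (- s) Q + P + smult (1/2) (Q * Q) + smult e (D2 R Q)"
  define T' where "T' = smult (- s) P + Q + P * Q + smult a (D2 R Q) + smult g (D2 R P)"
  have dU: "degree U' = 0" and dT: "degree T' = 0"
    using U T by (simp_all add: U'_def T'_def pderiv_eq_0_iff)
  have N1: "1 < N" using N by auto
  have Dle: "degree (smult c (D2 R f)) \<le> degree f + 2" for c f
    using degree_D2_le[OF R, of f] degree_smult_le[of c "D2 R f"] by linarith
  \<comment> \<open>N + 2 < 2 N amounts to \<open>2 < N\<close>; in the other alternative
    \<open>e\<close> is 0.\<close>
  have DQ: "degree (smult e (D2 R Q)) < 2 * N"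
    using Dle[of e Q] K N by (cases "e = 0") auto
  have sQ: "degree (smult c Q) \<le> N" for c using degree_smult_le[of c Q] K by simp
  \<comment> \<open>\<open>V\<close> equals P + Q^2/2 and has smaller degree than Q^2, so
    \<open>P\<close> inherits degree 2 N from -Q^2/2.\<close>
  define V where "V = U' - smult (- s) Q - smult e (D2 R Q)"
  have "degree V < 2 * N" unfolding V_def
    using dU DQ sQ[of "-s"] N1 by (intro degree_diff_less) auto
  moreover have "P = smult (-1/2) (Q * Q) + V"
    unfolding V_def U'_def by (simp add: flip: smult_minus_left) (simp add: smult_add_left[symmetric])
  moreover have dQQ: "degree (smult (-1/2) (Q * Q)) = 2 * N"
    using Q0 K by (simp add: degree_mult_eq)
  ultimately have dP: "degree P = 2 * N"
    by (metis degree_add_eq_left)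
  have P0: "P \<noteq> 0" using dP N1 by auto
  have "degree (P * Q) = 3 * N" using P0 Q0 dP K by (simp add: degree_mult_eq)
  \<comment> \<open>The right-hand side stays below degree 3 N: the \<open>D2\<close> terms reach at
    most N + 2 and 2 N + 2, and the latter is below 3 N if \<open>2 < N\<close> and absent if
    \<open>g = 0\<close>.\<close>
  moreover have "P * Q = T' - smult (- s) P - Q - smult a (D2 R Q) - smult g (D2 R P)"
    by (simp add: T'_def)
  moreover have "degree (smult g (D2 R P)) < 3 * N"
    using Dle[of g P] dP N by (cases "g = 0") auto
  then have "degree (T' - smult (- s) P - Q - smult a (D2 R Q) - smult g (D2 R P)) < 3 * N"
    using dT Dle[of a Q] degree_smult_le[of "-s" P] K dP N1 by (intro degree_diff_less) auto
  ultimately show False by simp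
qed

text \<open>For linear \<open>Q\<close> degrees alone give no contradiction, as \<open>P * Q\<close>
  and \<open>D2 R Q\<close> both have degree 3; the signs of their leading coefficients
  decide.\<close>

lemma profile_degree_neq_1:
  fixes P Q R :: "real poly"
  assumes R: "R = smult l ([:1, 0, -1:] * [:1 - \<mu>, 0, \<mu>:])" and l: "0 < l" "0 < \<mu>" and a: "0 < a"
    and U: "pderiv (smult (- s) Q + P + smult (1/2) (Q * Q)) = 0"
    and T: "pderiv (smult (- s) P + Q + P * Q + smult a (D2 R Q)) = 0"
  shows "degree Q \<noteq> 1"
proof
  assume "degree Q = 1"
  define u v where "u = coeff Q 0" and "v = coeff Q 1"
  have v: "v \<noteq> 0" using \<open>degree Q = 1\<close> by (metis degree_0 leading_coeff_0_iff v_def zero_neq_one)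
  have Q: "Q = [:u, v:]"
    using \<open>degree Q = 1\<close>
    by (intro poly_eqI) (auto simp: u_def v_def coeff_pCons coeff_eq_0 split: nat.split)
  define c where "c = coeff (smult (- s) Q + P + smult (1/2) (Q * Q)) 0"
  have "degree (smult (- s) Q + P + smult (1/2) (Q * Q)) = 0" using U by (simp add: pderiv_eq_0_iff)
  then have "smult (- s) Q + P + smult (1/2) (Q * Q) = [:c:]"
    unfolding c_def by (metis degree_eq_zeroE coeff_pCons_0)
  then have P: "P = [:c:] + smult s Q - smult (1/2) (Q * Q)"
    by (simp add: algebra_simps)
  have dT: "degree (smult (- s) P + Q + P * Q + smult a (D2 R Q)) = 0" using T by (simp add: pderiv_eq_0_iff)
  have "coeff (smult (- s) P + Q + P * Q + smult a (D2 R Q)) 3 = 0"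
    by (rule coeff_eq_0) (unfold dT, simp)
  \<comment> \<open>\<open>P * Q\<close> contributes -v^3/2 and the \<open>D2\<close> term -2 a l
    \<mu> v, as \<open>R\<close> has leading coefficient -l \<mu>; the other terms have degree at
    most 2.\<close>
  then have "v * (v\<^sup>2 / 2 + 2 * a * l * \<mu>) = 0"
    by (simp add: P Q R D2_def pderiv_pCons numeral_3_eq_3 power2_eq_square algebra_simps)
  moreover have "v\<^sup>2 / 2 + 2 * a * l * \<mu> > 0" using l a by (intro add_nonneg_pos) auto
  ultimately show False using v by simp
qed


section \<open>cn as an elliptic profile with infinite range\<close>

text \<open>Makes the square root in \<open>sndn\<close> differentiable. For \<open>m = 1\<close>
  the radicand is cos^2 of the amplitude arctan (sinh v), which never reaches pi/2 in size.\<close>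

lemma jacobi_delta_pos:
  assumes "0 \<le> m" "m \<le> 1"
  shows "0 < 1 - m\<^sup>2 * (sin (jacobi_am v m))\<^sup>2"
proof (cases "m = 1")
  case True
  have "0 < 1 + (sinh v)\<^sup>2" by (rule add_pos_nonneg) auto
  then have "0 < (cos (arctan (sinh v)))\<^sup>2" by (simp add: cos_arctan)
  then show ?thesis unfolding True jacobi_am_1 by (simp add: cos_squared_eq)
next
  case False
  then show ?thesis using delta_pos assms by simp
qed

text \<open>Differentiating through the amplitude avoids dividing by sn dn, so the formula also
  holds where sn vanishes, as \<open>z_deriv\<close> demands.\<close>

lemma sndn_deriv:
  assumes m: "0 \<le> m" "m \<le> 1"
  shows "((\<lambda>v. sndn v m) has_real_derivative jacobi_cn v m * (1 - 2 * m\<^sup>2 + 2 * m\<^sup>2 * (jacobi_cn v m)\<^sup>2)) (at v)"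
proof -
  define p where "p = jacobi_am v m"
  define q where "q = sqrt (1 - m\<^sup>2 * (sin p)\<^sup>2)"
  have pos: "0 < 1 - m\<^sup>2 * (sin p)\<^sup>2" unfolding p_def using m by (rule jacobi_delta_pos)
  have "((\<lambda>p. sin p * sqrt (1 - m\<^sup>2 * (sin p)\<^sup>2)) has_real_derivative
      cos p * q - m\<^sup>2 * (sin p)\<^sup>2 * cos p / q) (at p)"
    using pos by (auto intro!: derivative_eq_intros simp: q_def power2_eq_square field_simps)
  then have "((\<lambda>v. sndn v m) has_real_derivative (cos p * q - m\<^sup>2 * (sin p)\<^sup>2 * cos p / q) * q) (at v)"
    unfolding sndn_def p_def q_def by (rule DERIV_chain2) (rule jacobi_am_deriv[OF m])
  moreover have "(cos p * q - m\<^sup>2 * (sin p)\<^sup>2 * cos p / q) * q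
      = cos p * (1 - 2 * m\<^sup>2 + 2 * m\<^sup>2 * (cos p)\<^sup>2)"
  proof -
    have "q \<noteq> 0" "q\<^sup>2 = 1 - m\<^sup>2 * (sin p)\<^sup>2" using pos by (simp_all add: q_def)
    then have "(cos p * q - m\<^sup>2 * (sin p)\<^sup>2 * cos p / q) * q = cos p * (1 - 2 * (m\<^sup>2 * (sin p)\<^sup>2))"
      by (simp add: left_diff_distrib right_diff_distrib power2_eq_square mult.assoc)
    also have "\<dots> = cos p * (1 - 2 * m\<^sup>2 + 2 * m\<^sup>2 * (cos p)\<^sup>2)"
      by (simp add: sin_squared_eq algebra_simps)
    finally show ?thesis .
  qed
  ultimately show ?thesis
    unfolding jacobi_cn_def p_def by (rule DERIV_cong)
qed

text \<open>The right-hand side of y'^2 = R(y) for y = cn (lam x, m); the factor lam^2 comes from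
  the chain rule.\<close>

definition cn_quartic :: "real \<Rightarrow> real \<Rightarrow> real poly" where
  "cn_quartic lam m = smult (lam\<^sup>2) ([:1, 0, -1:] * [:1 - m\<^sup>2, 0, m\<^sup>2:])"

lemma poly_cn_quartic: "poly (cn_quartic lam m) t = lam\<^sup>2 * ((1 - t\<^sup>2) * (1 - m\<^sup>2 + m\<^sup>2 * t\<^sup>2))"
  by (simp add: cn_quartic_def power2_eq_square algebra_simps)

lemma poly_pderiv_cn_quartic:
  "poly (pderiv (cn_quartic lam m)) t / 2 = - lam\<^sup>2 * (t * (1 - 2 * m\<^sup>2 + 2 * m\<^sup>2 * t\<^sup>2))"
  by (simp add: cn_quartic_def pderiv_pCons pderiv_smult power2_eq_square field_simps)

lemma degree_cn_quartic: "degree (cn_quartic lam m) \<le> 4"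
  by (simp add: cn_quartic_def)

lemma elliptic_profile_cn:
  assumes m: "0 \<le> m" "m \<le> 1"
  shows "elliptic_profile (\<lambda>x. jacobi_cn (lam * x) m) (\<lambda>x. - lam * sndn (lam * x) m) (cn_quartic lam m)"
proof
  fix x
  have L: "((\<lambda>x. lam * x) has_real_derivative lam) (at x)"
    by (auto intro!: derivative_eq_intros)
  show "((\<lambda>x. jacobi_cn (lam * x) m) has_real_derivative - lam * sndn (lam * x) m) (at x)"
    using DERIV_chain2[OF jacobi_cn_deriv[OF m] L] by (simp add: mult.commute)
  show "(- lam * sndn (lam * x) m)\<^sup>2 = poly (cn_quartic lam m) (jacobi_cn (lam * x) m)"
    by (simp add: poly_cn_quartic power_mult_distrib sndn_sq[OF m])
  show "((\<lambda>x. - lam * sndn (lam * x) m) has_real_derivative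
      poly (pderiv (cn_quartic lam m)) (jacobi_cn (lam * x) m) / 2) (at x)"
    using DERIV_cmult[OF DERIV_chain2[OF sndn_deriv[OF m] L], of "- lam"]
    unfolding poly_pderiv_cn_quartic by (simp add: power2_eq_square mult_ac)
qed

text \<open>A finite connected range would be one point, making \<open>z\<close> and its derivative
  zero; but at 0, where cn is 1, that derivative is -lam^2.\<close>

lemma infinite_range_cn:
  assumes m: "0 \<le> m" "m \<le> 1" and "lam \<noteq> 0"
  shows "infinite (range (\<lambda>x. jacobi_cn (lam * x) m))"
proof
  define y where "y x = jacobi_cn (lam * x) m" for x
  define z where "z x = - lam * sndn (lam * x) m" for x
  interpret elliptic_profile y z "cn_quartic lam m"
    using elliptic_profile_cn[OF m, of lam] by (simp add: y_def[abs_def] z_def[abs_def])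
  assume "finite (range (\<lambda>x. jacobi_cn (lam * x) m))"
  then have "finite (range y)" by (simp add: y_def[abs_def])
  moreover have "connected (range y)"
    by (rule connected_continuous_image)
      (auto intro!: continuous_at_imp_continuous_on DERIV_isCont[OF y_deriv])
  ultimately obtain C where "range y = {C}" using connected_finite_iff_sing[of "range y"] by auto
  then have "y = (\<lambda>_. C)" by auto
  then have "z x = 0" for x using DERIV_unique[OF y_deriv[of x]] by simp
  then have "z = (\<lambda>_. 0)" by auto
  then have "poly (pderiv (cn_quartic lam m)) (y 0) / 2 = 0"
    using DERIV_unique[OF z_deriv[of 0], of 0] by simp
  then show False
    unfolding poly_pderiv_cn_quartic using \<open>lam \<noteq> 0\<close> by (simp add: y_def jacobi_cn_0[OF m])
qed

section \<open>Passage to coefficients and conclusion\<close>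

text \<open>\<open>n\<close> may lie on either side of \<open>N\<close>, so both sums are padded to
  the larger bound.\<close>

lemma sum_extend_zero:
  fixes f :: "nat \<Rightarrow> real"
  assumes "\<And>r. r > n \<Longrightarrow> f r = 0" "\<And>r. r > N \<Longrightarrow> f r = 0"
  shows "(\<Sum>r=0..n. f r) = (\<Sum>r=0..N. f r)"
proof -
  have "(\<Sum>r=0..M. f r) = (\<Sum>r=0..max n N. f r)" if "M = n \<or> M = N" for M
    using assms that by (intro sum.mono_neutral_left) auto
  then show ?thesis by metis
qed

theorem theorem3p2:
  fixes a b c d lam m \<sigma> :: real and n :: nat and j k :: "nat \<Rightarrow> real"
    and \<eta> w :: "real \<Rightarrow> real"
  assumes "admissible a b c d" and "c = 0"
    and "lam > 0" and "0 < m" and "m \<le> 1"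
    and "\<And>r. r > n \<Longrightarrow> j r = 0" and "\<And>r. r > n \<Longrightarrow> k r = 0"
    and "\<And>\<xi>. \<eta> \<xi> = (\<Sum>r=0..n. j r * jacobi_cn (lam * \<xi>) m ^ r)"
    and "\<And>\<xi>. w \<xi> = (\<Sum>r=0..n. k r * jacobi_cn (lam * \<xi>) m ^ r)"
    and "abcd_solution a b c d (\<lambda>x t. \<eta> (x - \<sigma> * t)) (\<lambda>x t. w (x - \<sigma> * t))"
  shows "(b\<^sup>2 + d\<^sup>2 \<noteq> 0 \<longrightarrow>
            (\<forall>r\<ge>5. j r = 0) \<and> (\<forall>r\<ge>3. k r = 0) \<and>
            (\<forall>\<xi>. \<eta> \<xi> = (\<Sum>r=0..4. j r * jacobi_cn (lam * \<xi>) m ^ r)) \<and>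
            (\<forall>\<xi>. w \<xi> = (\<Sum>r=0..2. k r * jacobi_cn (lam * \<xi>) m ^ r))) \<and>
         (b\<^sup>2 + d\<^sup>2 = 0 \<longrightarrow>
            (\<forall>r\<ge>1. j r = 0 \<and> k r = 0) \<and>
            (\<exists>C. \<forall>\<xi>. \<eta> \<xi> = C) \<and> (\<exists>C. \<forall>\<xi>. w \<xi> = C))"
proof -
  have m: "0 \<le> m" "m \<le> 1" using assms by auto
  define y where "y x = jacobi_cn (lam * x) m" for x
  define z where "z x = - lam * sndn (lam * x) m" for x
  define R where "R = cn_quartic lam m"
  interpret elliptic_profile y z R
    using elliptic_profile_cn[OF m, of lam] by (simp add: y_def[abs_def] z_def[abs_def] R_def)
  define P where "P = (\<Sum>r=0..n. monom (j r) r)"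
  define Q where "Q = (\<Sum>r=0..n. monom (k r) r)"
  have cP: "coeff P r = j r" and cQ: "coeff Q r = k r" for r
    using assms(6,7) by (auto simp: P_def Q_def coeff_sum not_le[symmetric])
  have \<eta>: "\<eta> = (\<lambda>x. poly P (y x))" and w: "w = (\<lambda>x. poly Q (y x))"
    by (auto simp: P_def Q_def poly_sum poly_monom assms(8,9) y_def)
  have prod: "(\<lambda>x. poly P (y x) * poly Q (y x)) = (\<lambda>x. poly (P * Q) (y x))" by simp
  \<comment> \<open>The two traveling-wave equations are \<open>pderiv T\<close> and
    \<open>pderiv U\<close> at \<open>y\<close>, each times y'.\<close>
  define T where "T = smult (- \<sigma>) P + Q + P * Q + smult a (D2 R Q) + smult (b * \<sigma>) (D2 R P)"
  define U where "U = smult (- \<sigma>) Q + P + smult (1/2) (Q * Q) + smult (d * \<sigma>) (D2 R Q)"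
  have ode: "poly (pderiv T) (y x) * z x = 0 \<and> poly (pderiv U) (y x) * z x = 0" for x
  proof -
    have "abcd_solution a b c d (\<lambda>x t. poly P (y (x - \<sigma> * t))) (\<lambda>x t. poly Q (y (x - \<sigma> * t)))"
      using assms(10) by (simp add: \<eta> w)
    from this[unfolded abcd_solution_travel_iff[of "\<lambda>x. poly P (y x)" "\<lambda>x. poly Q (y x)", OF differentiable differentiable],
        unfolded deriv3, unfolded prod deriv1 \<open>c = 0\<close>]
    show ?thesis
      unfolding T_def U_def
      by (simp add: pderiv_add pderiv_smult pderiv_mult pderiv_diff algebra_simps)
  qed
  have R0: "R \<noteq> 0"
  proof
    assume "R = 0"
    \<comment> \<open>The values are -3 lam^2 (1 + 3 m^2) at 2 and lam^2 (1 - m^2) at 0; they cannot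
      both vanish.\<close>
    then have "poly R 2 = 0" "poly R 0 = 0" by simp_all
    then show False using \<open>lam > 0\<close> by (simp add: R_def poly_cn_quartic)
  qed
  have inf: "infinite (range y)"
    using infinite_range_cn[OF m, of lam] \<open>lam > 0\<close> by (simp add: y_def[abs_def])
  have T: "pderiv T = 0" and U: "pderiv U = 0"
    using poly_eq_0I[OF R0 inf] ode by blast+
  have R4: "degree R \<le> 4" by (simp add: R_def degree_cn_quartic)
  note deg = profile_degree_neq[OF R4 U[unfolded U_def] T[unfolded T_def]]
  \<comment> \<open>With \<open>N\<close> taken as the degree of \<open>Q\<close> itself,
    \<open>2 < N\<close> is contradictory.\<close>
  have Q2: "degree Q \<le> 2" using deg[of "degree Q"] by (metis not_le)
  have dU: "degree U = 0" using U by (simp add: pderiv_eq_0_iff)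
  \<comment> \<open>\<open>U\<close> is constant, so Q^2 and \<open>D2 R Q\<close>, of degree at
    most 4, bound the degree of \<open>P\<close>.\<close>
  have "P = U - smult (- \<sigma>) Q - smult (1/2) (Q * Q) - smult (d * \<sigma>) (D2 R Q)"
    by (simp add: U_def)
  also have "degree \<dots> \<le> 4"
    using dU Q2 degree_mult_le[of Q Q] degree_D2_le[OF R4, of Q]
    by (intro degree_diff_le order.trans[OF degree_smult_le]) auto
  finally have P4: "degree P \<le> 4" .
  have j5: "j r = 0" if "r \<ge> 5" for r using P4 that by (simp flip: cP add: coeff_eq_0)
  have k3: "k r = 0" if "r \<ge> 3" for r using Q2 that by (simp flip: cQ add: coeff_eq_0)
  have "\<eta> x = (\<Sum>r=0..4. j r * jacobi_cn (lam * x) m ^ r)" for x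
    unfolding assms(8) by (rule sum_extend_zero) (use assms(6) j5 in auto)
  moreover have "w x = (\<Sum>r=0..2. k r * jacobi_cn (lam * x) m ^ r)" for x
    unfolding assms(9) by (rule sum_extend_zero) (use assms(7) k3 in auto)
  moreover have "degree P = 0 \<and> degree Q = 0" if "b\<^sup>2 + d\<^sup>2 = 0"
  proof -
    have bd: "b = 0" "d = 0" using that by (auto simp: sum_power2_eq_zero_iff)
    have a: "0 < a" using assms(1,2) bd by (auto simp: admissible_def)
    have "degree Q \<noteq> 1"
      by (rule profile_degree_neq_1[where l = "lam\<^sup>2" and \<mu> = "m\<^sup>2", OF R_def[unfolded cn_quartic_def] _ _ a])
        (use U T assms(3,4) in \<open>simp_all add: U_def T_def bd\<close>)
    \<comment> \<open>For \<open>b = d = 0\<close> the second alternative in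
      \<open>profile_degree_neq\<close> admits N = 2.\<close>
    moreover have "degree Q \<noteq> 2" using deg[of 2] bd by simp
    ultimately have dQ: "degree Q = 0" using Q2 by linarith
    then have "pderiv Q = 0" by (simp add: pderiv_eq_0_iff)
    then have "pderiv P = 0"
      using U by (simp add: U_def bd pderiv_add pderiv_smult pderiv_mult pderiv_diff)
    with dQ show ?thesis by (simp add: pderiv_eq_0_iff)
  qed
  moreover have "(\<forall>r\<ge>1. j r = 0 \<and> k r = 0) \<and> (\<exists>C. \<forall>\<xi>. \<eta> \<xi> = C) \<and> (\<exists>C. \<forall>\<xi>. w \<xi> = C)"
    if "degree P = 0 \<and> degree Q = 0"
  proof -
    from that obtain p q where "P = [:p:]" "Q = [:q:]" by (metis degree_eq_zeroE)
    then show ?thesis using that by (auto simp: \<eta> w coeff_eq_0 simp flip: cP cQ)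
  qed
  ultimately show ?thesis using j5 k3 by blast
qed

end
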